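(* For every $n\ge 1$ there exists, up to flips, exactly one degenerable formal $n$-cube $X\colon\{0,1\}^n\to\mathrm{Sub}[n]$ such that the full label $\{0,\dots,n\}$ is not a value of $X$ and every $n$-element subset of $\{0,\dots,n\}$ is the value of $X$ at precisely one point of $\{0,1\}^n$.
   Context: $\mathrm{Sub}[n]$ is the set of nonempty subsets of $\{0,\dots,n\}$. A formal $n$-cube with labels in $[n]$ is a map $X\colon\{0,1\}^n\to\mathrm{Sub}[n]$; points are $x=(x_0,\dots,x_{n-1})$. Its label functions are $f_0,\dots,f_n\colon\{0,1\}^n\to\{0,1\}$, $f_i(x)=1\iff i\in X(x)$. $X$ is degenerable if for every $0\le i<n$, pushing the labels forward along the degeneracy $\sigma_i\colon[n]\to[n-1]$ identifying $i$ and $i+1$ gives a map $\{0,1\}^n\to\mathrm{Sub}[n-1]$, $x\mapsto\sigma_i(X(x))$, that does not depend on $x_i$. "Up to flips" means up to precomposition with maps $\{0,1\}^n\to\{0,1\}^n$ that negate a set of coordinates. *)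

theory Defs
  imports Main "HOL-Library.FuncSet"
begin

definition Sub :: "nat \<Rightarrow> nat set set" where
  "Sub n = {S. S \<subseteq> {0..n} \<and> S \<noteq> {}}"

definition cube :: "nat \<Rightarrow> (nat \<Rightarrow> nat) set" where
  "cube n = {..<n} \<rightarrow>\<^sub>E {0, 1}"

text \<open>Points and formal cubes are extensional functions, so that \<open>=\<close> is equality of maps
  on \<open>{0,1}\<^sup>n\<close>.\<close>

definition formal_cubes :: "nat \<Rightarrow> ((nat \<Rightarrow> nat) \<Rightarrow> nat set) set" where
  "formal_cubes n = cube n \<rightarrow>\<^sub>E Sub n"

definition degen :: "nat \<Rightarrow> nat \<Rightarrow> nat" where
  "degen i k = (if k \<le> i then k else k - 1)"

definition independent_of_coord :: "nat \<Rightarrow> nat \<Rightarrow> ((nat \<Rightarrow> nat) \<Rightarrow> 'b) \<Rightarrow> bool" where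
  "independent_of_coord n i F \<longleftrightarrow>
     (\<forall>x\<in>cube n. \<forall>y\<in>cube n. (\<forall>j<n. j \<noteq> i \<longrightarrow> x j = y j) \<longrightarrow> F x = F y)"

definition degenerable :: "nat \<Rightarrow> ((nat \<Rightarrow> nat) \<Rightarrow> nat set) \<Rightarrow> bool" where
  "degenerable n X \<longleftrightarrow> (\<forall>i<n. independent_of_coord n i (\<lambda>x. degen i ` X x))"

definition flip :: "nat \<Rightarrow> nat set \<Rightarrow> (nat \<Rightarrow> nat) \<Rightarrow> (nat \<Rightarrow> nat)" where
  "flip n A x = (\<lambda>j\<in>{..<n}. if j \<in> A then 1 - x j else x j)"

definition flip_equivalent ::
    "nat \<Rightarrow> ((nat \<Rightarrow> nat) \<Rightarrow> nat set) \<Rightarrow> ((nat \<Rightarrow> nat) \<Rightarrow> nat set) \<Rightarrow> bool" where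
  "flip_equivalent n X Y \<longleftrightarrow> (\<exists>A\<subseteq>{..<n}. Y = (\<lambda>x\<in>cube n. X (flip n A x)))"

definition admissible :: "nat \<Rightarrow> ((nat \<Rightarrow> nat) \<Rightarrow> nat set) \<Rightarrow> bool" where
  "admissible n X \<longleftrightarrow>
     X \<in> formal_cubes n \<and> degenerable n X \<and>
     {0..n} \<notin> X ` cube n \<and>
     (\<forall>S. S \<subseteq> {0..n} \<and> card S = n \<longrightarrow> (\<exists>!x. x \<in> cube n \<and> X x = S))"

end

(* For x in {0,1}^n put x_(-1) = 1 and x_n = 0, and call i a descent of x if x_(i-1) = 1 and
   x_i = 0. The solution X sends x to the set of its non-descents: there is always a descent, two
   adjacent labels are never both descents, and exactly one descent at i forces x = 1...10...0.
   For uniqueness, let p_i be the point where Y misses exactly the label i. Flipping p_i in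
   coordinate i can only change the labels i and i+1 and keeps at least one of them, so the result
   is p_(i+1). After flips p_i = 1...10...0. Since membership of i in Y x depends only on x_(i-1)
   and x_i, the points p_j settle it unless (x_(i-1), x_i) = (0,1). In that case we may assume that
   x agrees with p_(i+1) except in coordinate i - 1. Then label i - 1 is missing, and degenerability
   in that coordinate forces label i to be present. *)
theory Submission
  imports Defs
begin

section \<open>Degeneracies, points of the cube and flips\<close>

lemma degen_image_eq_iff:
  "degen i ` S = degen i ` T \<longleftrightarrow>
     (\<forall>k. k \<noteq> i \<longrightarrow> k \<noteq> Suc i \<longrightarrow> (k \<in> S \<longleftrightarrow> k \<in> T)) \<and>
     (i \<in> S \<or> Suc i \<in> S \<longleftrightarrow> i \<in> T \<or> Suc i \<in> T)"
proof -
  \<comment> \<open>The pair \<open>{i, Suc i}\<close> is the only fibre of \<open>degen i\<close>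
    with more than one element.\<close>
  have eq: "degen i a = degen i b \<longleftrightarrow> a = b \<or> (a \<in> {i, Suc i} \<and> b \<in> {i, Suc i})" for a b
    by (auto simp: degen_def)
  have mem: "degen i k \<in> degen i ` U \<longleftrightarrow>
      (if k \<in> {i, Suc i} then i \<in> U \<or> Suc i \<in> U else k \<in> U)" for k U
    by (auto simp: image_iff eq)
  have "degen i ` S = degen i ` T \<longleftrightarrow> (\<forall>k. degen i k \<in> degen i ` S \<longleftrightarrow> degen i k \<in> degen i ` T)"
    by blast
  then show ?thesis
    unfolding mem by auto
qed

lemma cube_cases: "x \<in> cube n \<Longrightarrow> j < n \<Longrightarrow> x j = 0 \<or> x j = 1"
  unfolding cube_def by (drule PiE_mem[where x = j]) simp_all

lemma cube_eqI: "x \<in> cube n \<Longrightarrow> y \<in> cube n \<Longrightarrow> (\<And>j. j < n \<Longrightarrow> x j = y j) \<Longrightarrow> x = y"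
  unfolding cube_def by (rule PiE_ext) auto

lemma flip_apply: "j < n \<Longrightarrow> flip n A x j = (if j \<in> A then 1 - x j else x j)"
  by (simp add: flip_def)

lemma flip_in_cube:
  assumes "x \<in> cube n"
  shows "flip n A x \<in> cube n"
proof -
  have "flip n A x j \<in> {0, 1}" if "j < n" for j
    using cube_cases[OF assms that] that by (auto simp: flip_apply)
  then show ?thesis
    by (auto simp: flip_def cube_def restrict_PiE_iff)
qed

lemma card_eq_atLeastAtMost_diff:
  assumes "S \<subseteq> {0..n}" "card S = n"
  obtains i where "i \<le> n" "S = {0..n} - {i}"
proof -
  have "card ({0..n} - S) = 1"
    using assms by (simp add: card_Diff_subset finite_subset)
  then obtain i where i: "{0..n} - S = {i}"
    by (auto simp: card_1_singleton_iff)
  then have "i \<le> n"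
    by (metis Diff_iff atLeastAtMost_iff singletonI)
  moreover have "S = {0..n} - {i}"
    using double_diff[OF assms(1) subset_refl] i by simp
  ultimately show thesis by (rule that)
qed

section \<open>Descents of a point\<close>

definition up :: "(nat \<Rightarrow> nat) \<Rightarrow> nat \<Rightarrow> bool" where
  "up x i \<longleftrightarrow> i = 0 \<or> x (i - 1) = 1"

text \<open>The disjunct \<open>i = n\<close> encodes x_n = 0, and \<open>i = 0\<close> in
  \<open>up\<close> encodes x_(-1) = 1; truncated subtraction would otherwise read
  \<open>x 0\<close> there.\<close>

definition descent :: "nat \<Rightarrow> (nat \<Rightarrow> nat) \<Rightarrow> nat \<Rightarrow> bool" where
  "descent n x i \<longleftrightarrow> up x i \<and> (i = n \<or> x i = 0)"

definition nondescent_cube :: "nat \<Rightarrow> (nat \<Rightarrow> nat) \<Rightarrow> nat set" where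
  "nondescent_cube n = (\<lambda>x\<in>cube n. {i \<in> {0..n}. \<not> descent n x i})"

lemma up_propagate:
  assumes "x \<in> cube n" "up x a" "a \<le> b" "b \<le> n" "\<And>k. a \<le> k \<Longrightarrow> k < b \<Longrightarrow> \<not> descent n x k"
  shows "up x b"
  using assms(3,4,5)
proof (induction b rule: dec_induct)
  case base
  show ?case by fact
next
  case (step k)
  then have "up x k" "\<not> descent n x k" by auto
  then show ?case
    using cube_cases[OF assms(1), of k] step.prems(1) by (auto simp: up_def descent_def)
qed

lemma adjacent_not_descent: "i < n \<Longrightarrow> \<not> descent n x i \<or> \<not> descent n x (Suc i)"
  by (auto simp: descent_def up_def)

text \<open>Without a descent the initial 1 at position -1 would propagate to position n - 1, making
  \<open>n\<close> itself a descent.\<close>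

lemma exists_descent:
  assumes "x \<in> cube n"
  shows "\<exists>i\<le>n. descent n x i"
proof (rule ccontr)
  assume "\<not> ?thesis"
  moreover from this have "up x n"
    using up_propagate[OF assms, of 0 n] by (auto simp: up_def)
  ultimately show False by (auto simp: descent_def)
qed

text \<open>Ones propagate from the left end up to the first descent. A one at some j with i \<le> j
  < n would propagate to the right end and make \<open>n\<close> a second descent.\<close>

lemma single_descent_iff:
  assumes x: "x \<in> cube n" and i: "i \<le> n"
  shows "(\<forall>k\<le>n. descent n x k \<longleftrightarrow> k = i) \<longleftrightarrow> x = (\<lambda>j\<in>{..<n}. if j < i then 1 else 0)"
    (is "?L \<longleftrightarrow> ?R")
proof
  assume L: ?L
  have "x j = 1" if "j < i" for j
    using up_propagate[OF x, of 0 "Suc j"] that i L by (auto simp: up_def)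
  moreover have "x j = 0" if "i \<le> j" "j < n" for j
  proof (rule ccontr)
    assume "x j \<noteq> 0"
    then have "up x (Suc j)"
      using cube_cases[OF x \<open>j < n\<close>] by (simp add: up_def)
    then have "up x n"
      using up_propagate[OF x, of "Suc j" n] that L by auto
    then have "descent n x n" by (simp add: descent_def)
    with L that show False by auto
  qed
  ultimately show ?R
    by (intro cube_eqI[OF x]) (auto simp: cube_def)
next
  assume ?R
  then show ?L
    using i by (auto simp: descent_def up_def split: if_splits)
qed

section \<open>Existence\<close>

lemma admissible_nondescent_cube:
  assumes "n \<ge> 1"
  shows "admissible n (nondescent_cube n)"
  unfolding admissible_def
proof (intro conjI allI impI)
  \<comment> \<open>This gives nonempty values: as n \<ge> 1, both 0 and 1 are labels.\<close>
  have "\<not> descent n x 0 \<or> \<not> descent n x 1" for x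
    using adjacent_not_descent[of 0 n x] assms by auto
  then show "nondescent_cube n \<in> formal_cubes n"
    using assms unfolding formal_cubes_def nondescent_cube_def Sub_def
    by (intro restrict_PiE_iff[THEN iffD2] ballI) fastforce
  show "degenerable n (nondescent_cube n)"
    unfolding degenerable_def independent_of_coord_def
  proof (intro allI impI ballI)
    fix i x y
    assume i: "i < n" and xy: "x \<in> cube n" "y \<in> cube n" and agree: "\<forall>j<n. j \<noteq> i \<longrightarrow> x j = y j"
    \<comment> \<open>Coordinate \<open>i\<close> enters only the descent conditions at
      \<open>i\<close> and \<open>Suc i\<close>. Each of \<open>x\<close> and \<open>y\<close> keeps
      at least one of these two labels, so the images agree.\<close>
    have "descent n x k \<longleftrightarrow> descent n y k" if "k \<noteq> i" "k \<noteq> Suc i" "k \<le> n" for k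
    proof -
      have "k = 0 \<or> k - 1 < n \<and> k - 1 \<noteq> i" "k = n \<or> k < n"
        using that by arith+
      then have "k = 0 \<or> x (k - 1) = y (k - 1)" "k = n \<or> x k = y k"
        using agree that by blast+
      then show ?thesis by (auto simp: descent_def up_def)
    qed
    then show "degen i ` nondescent_cube n x = degen i ` nondescent_cube n y"
      using i xy adjacent_not_descent[OF i] by (auto simp: degen_image_eq_iff nondescent_cube_def)
  qed
  show "{0..n} \<notin> nondescent_cube n ` cube n"
    using exists_descent by (force simp: nondescent_cube_def)
  fix S :: "nat set"
  assume "S \<subseteq> {0..n} \<and> card S = n"
  then obtain i where i: "i \<le> n" "S = {0..n} - {i}"
    using card_eq_atLeastAtMost_diff by metis
  have "nondescent_cube n x = S \<longleftrightarrow> x = (\<lambda>j\<in>{..<n}. if j < i then 1 else 0)"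
    if "x \<in> cube n" for x
  proof -
    have "nondescent_cube n x = S \<longleftrightarrow> (\<forall>k\<le>n. descent n x k \<longleftrightarrow> k = i)"
      using that i(1) unfolding i(2) nondescent_cube_def by fastforce
    then show ?thesis
      unfolding single_descent_iff[OF that i(1)] .
  qed
  moreover have "(\<lambda>j\<in>{..<n}. if j < i then 1 else 0) \<in> cube n"
    by (auto simp: cube_def)
  ultimately show "\<exists>!x. x \<in> cube n \<and> nondescent_cube n x = S"
    by blast
qed

section \<open>Uniqueness\<close>

lemma degenerable_image_eq:
  assumes "degenerable n Y" "i < n" "x \<in> cube n" "y \<in> cube n"
    and "\<And>j. j < n \<Longrightarrow> j \<noteq> i \<Longrightarrow> x j = y j"
  shows "degen i ` Y x = degen i ` Y y"
  using assms(1)[unfolded degenerable_def independent_of_coord_def, rule_format, OF assms(2-4)]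
    assms(5) by simp

lemma degenerable_mem_cong:
  assumes Y: "degenerable n Y" and x: "x \<in> cube n" and y: "y \<in> cube n"
    and agree: "\<And>j. j < n \<Longrightarrow> j = i \<or> Suc j = i \<Longrightarrow> x j = y j"
  shows "i \<in> Y x \<longleftrightarrow> i \<in> Y y"
proof -
  \<comment> \<open>The hybrids \<open>h m\<close> lead from \<open>y\<close> to \<open>x\<close>
    one coordinate at a time. Changing coordinate \<open>m\<close> can affect only the labels
    \<open>m\<close> and \<open>Suc m\<close>; for these, \<open>agree\<close> makes the step
    trivial.\<close>
  define h where "h m = (\<lambda>j\<in>{..<n}. if j < m then x j else y j)" for m
  have h: "h m \<in> cube n" for m
    unfolding h_def using cube_cases[OF x] cube_cases[OF y] by (auto simp: cube_def)
  have "i \<in> Y (h m) \<longleftrightarrow> i \<in> Y y" if "m \<le> n" for m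
    using that
  proof (induction m)
    case 0
    have "h 0 = y"
      by (rule cube_eqI[OF h y]) (simp add: h_def)
    then show ?case by simp
  next
    case (Suc m)
    have "i \<in> Y (h (Suc m)) \<longleftrightarrow> i \<in> Y (h m)"
    proof (cases "m = i \<or> Suc m = i")
      case True
      then have "h (Suc m) = h m"
        using agree[of m] Suc.prems
        by (intro cube_eqI[OF h h]) (auto simp: h_def less_Suc_eq)
      then show ?thesis by simp
    next
      case False
      have "degen m ` Y (h (Suc m)) = degen m ` Y (h m)"
        using Suc.prems by (intro degenerable_image_eq[OF Y _ h h]) (auto simp: h_def less_Suc_eq)
      then show ?thesis
        using False by (auto simp: degen_image_eq_iff)
    qed
    with Suc show ?case by simp
  qed
  moreover have "h n = x"
    by (rule cube_eqI[OF h x]) (simp add: h_def)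
  ultimately show ?thesis by auto
qed

lemma admissible_staircase:
  assumes Y: "admissible n Y" and p: "p \<in> cube n" and Yp: "Y p = {0..n} - {0}"
    and i: "i \<le> n"
  shows "Y (flip n {..<i} p) = {0..n} - {i}"
  using i
proof (induction i)
  case 0
  have "flip n {..<0} p = p"
    by (rule cube_eqI[OF flip_in_cube[OF p] p]) (simp add: flip_apply)
  then show ?case using Yp by simp
next
  case (Suc i)
  let ?p = "flip n {..<i} p" and ?q = "flip n {..<Suc i} p"
  have p_cube: "?p \<in> cube n" and q_cube: "?q \<in> cube n"
    using flip_in_cube[OF p] by auto
  have deg: "degenerable n Y"
    using Y by (simp add: admissible_def)
  have IH: "Y ?p = {0..n} - {i}"
    using Suc by simp
  have "degen i ` Y ?p = degen i ` Y ?q"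
    using Suc.prems
    by (intro degenerable_image_eq[OF deg _ p_cube q_cube]) (auto simp: flip_apply)
  then have other: "\<And>k. k \<noteq> i \<Longrightarrow> k \<noteq> Suc i \<Longrightarrow> k \<in> Y ?q \<longleftrightarrow> k \<le> n"
    and either: "i \<in> Y ?q \<or> Suc i \<in> Y ?q"
    using Suc.prems by (auto simp: degen_image_eq_iff IH)
  have sub: "Y ?q \<subseteq> {0..n}"
    using Y PiE_mem[OF _ q_cube, of Y "\<lambda>_. Sub n"]
    by (simp add: admissible_def formal_cubes_def Sub_def)
  have "Y ?q \<noteq> {0..n}"
    using Y q_cube unfolding admissible_def by blast
  \<comment> \<open>Equality would give two points with the same n-element value, but
    \<open>?p\<close> and \<open>?q\<close> differ in coordinate \<open>i\<close>.\<close>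
  moreover have "Y ?q \<noteq> {0..n} - {i}"
  proof
    assume "Y ?q = {0..n} - {i}"
    moreover have "card ({0..n} - {i}) = n"
      using Suc.prems by simp
    ultimately have "?q = ?p"
      using Y IH p_cube q_cube unfolding admissible_def by blast
    then have "?q i = ?p i" by simp
    then show False
      using Suc.prems cube_cases[OF p, of i] by (auto simp: flip_apply)
  qed
  \<comment> \<open>Only the trace on \<open>{i, Suc i}\<close> is open; both exclusions above leave
    \<open>{i}\<close>.\<close>
  moreover have "Y ?q = {0..n} - {i, Suc i} \<union> (Y ?q \<inter> {i, Suc i})"
    using other sub by (intro set_eqI) (metis Diff_iff Int_iff Un_iff atLeastAtMost_iff insert_iff empty_iff le0 subsetD)
  moreover have "{0..n} = {0..n} - {i, Suc i} \<union> {i, Suc i}"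
    and "{0..n} - {i} = {0..n} - {i, Suc i} \<union> {Suc i}"
    and "{0..n} - {Suc i} = {0..n} - {i, Suc i} \<union> {i}"
    using Suc.prems by auto
  moreover have "Y ?q \<inter> {i, Suc i} \<in> {{i}, {Suc i}, {i, Suc i}}"
    using either by auto
  ultimately show ?case
    by (metis insertE empty_iff)
qed

text \<open>Instead of normalising by flips, the descent condition is read relative to
  \<open>p\<close>: differing from \<open>p\<close> counts as 1, agreeing as 0. Hence
  \<open>p\<close> alone determines \<open>Y\<close>.\<close>

lemma admissible_mem_iff:
  assumes Y: "admissible n Y" and p: "p \<in> cube n" and Yp: "Y p = {0..n} - {0}"
    and x: "x \<in> cube n" and i: "i \<le> n"
  shows "i \<in> Y x \<longleftrightarrow> \<not> ((i = 0 \<or> x (i - 1) \<noteq> p (i - 1)) \<and> (i = n \<or> x i = p i))"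
proof -
  let ?s = "\<lambda>k. flip n {..<k} p"
  have deg: "degenerable n Y"
    using Y by (simp add: admissible_def)
  have s_cube: "?s k \<in> cube n" for k
    using flip_in_cube[OF p] .
  have Ys: "k \<in> Y (?s m) \<longleftrightarrow> k \<noteq> m" if "k \<le> n" "m \<le> n" for k m
    unfolding admissible_staircase[OF Y p Yp that(2)] using that(1) by simp
  have ne: "1 - p j = z j \<longleftrightarrow> z j \<noteq> p j" if "z \<in> cube n" "j < n" for z j
    using cube_cases[OF that] cube_cases[OF p that(2)] by (elim disjE) simp_all
  \<comment> \<open>Near label \<open>k\<close> the point \<open>z\<close> looks like
    \<open>?s k\<close>. A general \<open>z\<close> is needed because the mixed case below applies
    this to an auxiliary point.\<close>
  have missing: "k \<notin> Y z"
    if "z \<in> cube n" "k \<le> n" "k = 0 \<or> z (k - 1) \<noteq> p (k - 1)" "k = n \<or> z k = p k" for z k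
  proof -
    have "k \<in> Y (?s k) \<longleftrightarrow> k \<in> Y z"
      using that ne[OF that(1)]
      by (intro degenerable_mem_cong[OF deg s_cube]) (auto simp: flip_apply)
    then show ?thesis using Ys[of k k] that(2) by blast
  qed
  have present: "i \<in> Y x" if touch: "i > 0 \<and> x (i - 1) = p (i - 1) \<or> i < n \<and> x i \<noteq> p i"
  proof -
    \<comment> \<open>In the first two cases \<open>x\<close> agrees in coordinates i - 1 and i with
      \<open>?s 0\<close> or \<open>?s (Suc i)\<close>, each missing a label other than
      \<open>i\<close>. The mixed pattern occurs in no \<open>?s k\<close>.\<close>
    consider (same) "i > 0" "x (i - 1) = p (i - 1)" "i = n \<or> x i = p i"
      | (flipped) "i < n" "x i \<noteq> p i" "i = 0 \<or> x (i - 1) \<noteq> p (i - 1)"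
      | (mixed) "i > 0" "i < n" "x (i - 1) = p (i - 1)" "x i \<noteq> p i"
      using touch i by linarith
    then show ?thesis
    proof cases
      case same
      have "i \<in> Y (?s 0) \<longleftrightarrow> i \<in> Y x"
        using same by (intro degenerable_mem_cong[OF deg s_cube x]) (auto simp: flip_apply)
      then show ?thesis using Ys[of i 0] i same(1) by blast
    next
      case flipped
      have "i \<in> Y (?s (Suc i)) \<longleftrightarrow> i \<in> Y x"
        using flipped ne[OF x]
        by (intro degenerable_mem_cong[OF deg s_cube x]) (auto simp: flip_apply)
      then show ?thesis using Ys[of i "Suc i"] i flipped(1) by simp
    next
      case mixed
      \<comment> \<open>This point agrees with \<open>x\<close> in coordinates i - 1 and i, and with
        \<open>?s (Suc i)\<close> except in coordinate i - 1. It misses label i - 1, as coordinate i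
        - 2, if any, is flipped and i - 1 is not.\<close>
      define y where "y = flip n ({..<Suc i} - {i - 1}) p"
      have y: "y \<in> cube n"
        unfolding y_def using flip_in_cube[OF p] .
      have "degen (i - 1) ` Y y = degen (i - 1) ` Y (?s (Suc i))"
        using mixed by (intro degenerable_image_eq[OF deg _ y s_cube]) (auto simp: y_def flip_apply)
      then have "i - 1 \<in> Y y \<or> i \<in> Y y"
        using mixed Ys[of i "Suc i"] by (auto simp: degen_image_eq_iff)
      moreover have "i - 1 \<notin> Y y"
        using mixed ne[OF y, of "i - 1 - 1"]
        by (intro missing[OF y]) (auto simp: y_def flip_apply)
      moreover have "i \<in> Y y \<longleftrightarrow> i \<in> Y x"
        using mixed ne[OF x]
        by (intro degenerable_mem_cong[OF deg y x]) (auto simp: y_def flip_apply)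
      ultimately show ?thesis by blast
    qed
  qed
  show ?thesis
    using missing[OF x i] present i by (metis le_neq_implies_less not_gr_zero)
qed

lemma flip_equivalent_nondescent_cube:
  assumes Y: "admissible n Y"
  shows "flip_equivalent n (nondescent_cube n) Y"
proof -
  have "card ({0..n} - {0}) = n" by simp
  then obtain p where p: "p \<in> cube n" "Y p = {0..n} - {0}"
    using Y unfolding admissible_def by (metis Diff_subset)
  \<comment> \<open>Flipping along \<open>A\<close> moves \<open>p\<close> to the zero point, so a
    flipped coordinate is 1 exactly where \<open>x\<close> differs from \<open>p\<close>.\<close>
  define A where "A = {j. j < n \<and> p j = 1}"
  have Y_fun: "Y \<in> cube n \<rightarrow>\<^sub>E Sub n"
    using Y by (simp add: admissible_def formal_cubes_def)
  have "Y x = nondescent_cube n (flip n A x)" if x: "x \<in> cube n" for x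
  proof -
    have one: "flip n A x j = 1 \<longleftrightarrow> x j \<noteq> p j" and zero: "flip n A x j = 0 \<longleftrightarrow> x j = p j"
      if "j < n" for j
      using cube_cases[OF x that] cube_cases[OF p(1) that] that
      by (auto simp: flip_apply A_def)
    have "i \<in> Y x \<longleftrightarrow> \<not> descent n (flip n A x) i" if "i \<le> n" for i
    proof -
      have "i = 0 \<or> flip n A x (i - 1) = 1 \<longleftrightarrow> i = 0 \<or> x (i - 1) \<noteq> p (i - 1)"
        using one[of "i - 1"] that by fastforce
      moreover have "i = n \<or> flip n A x i = 0 \<longleftrightarrow> i = n \<or> x i = p i"
        using zero[of i] that by fastforce
      ultimately show ?thesis
        unfolding admissible_mem_iff[OF Y p x that] descent_def up_def by (simp only:)
    qed
    moreover have "Y x \<subseteq> {0..n}"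
      using PiE_mem[OF Y_fun x] by (simp add: Sub_def)
    ultimately show ?thesis
      using flip_in_cube[OF x] by (auto simp: nondescent_cube_def)
  qed
  then have "Y = (\<lambda>x\<in>cube n. nondescent_cube n (flip n A x))"
    using Y_fun by (intro extensionalityI[of Y "cube n"]) (auto simp: PiE_def)
  moreover have "A \<subseteq> {..<n}"
    by (auto simp: A_def)
  ultimately show ?thesis
    unfolding flip_equivalent_def by blast
qed

theorem mainTheorem6:
  fixes n :: nat
  assumes "n \<ge> 1"
  shows "\<exists>X. admissible n X \<and> (\<forall>Y. admissible n Y \<longrightarrow> flip_equivalent n X Y)"
  using admissible_nondescent_cube[OF assms] flip_equivalent_nondescent_cube by blast

end
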